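(* Let $\lambda=(\lambda_1\ge\dots\ge\lambda_n\ge0)$ be a partition with $n$ parts, $\tau\in S_n$, and let $F\in\mathrm{InvFree}(\tau\lambda,\tau w_0)$. Then $\mathrm{cocharge}(\mathrm{ccw}(F))=\mathrm{maj}(F)$.
   Context: For $\tau\in S_n$ and a sequence $a=(a_1,\dots,a_n)$, $\tau a=(a_{\tau^{-1}(1)},\dots,a_{\tau^{-1}(n)})$; $w_0=(n,n-1,\dots,1)$, so $\tau w_0=(n+1-\tau^{-1}(1),\dots,n+1-\tau^{-1}(n))$. Big basements: symbols $\infty_1,\dots,\infty_n$ with $\infty_i<\infty_j$ iff $i<j$ and $\infty_i>m$ for every positive integer $m$. For a composition $\alpha$ and permutation sequence $\sigma$, the augmented diagram of shape $\alpha$ has rows $1,\dots,n$ top to bottom, row $r$ consisting of boxes $(r,0),\dots,(r,\alpha_r)$, column $0$ the basement; a filling with big basement $\sigma$ has $F(r,0)=\infty_{\sigma_r}$ and positive integers elsewhere. A type $A$ triple is $a=(r,j-1)$, $b=(r,j)$, $c=(k,j)$ with $j\ge1$, $k>r$, $\alpha_r\ge\alpha_k$; a type $B$ triple is $a=(r,j-1)$, $b=(r,j)$, $c=(k,j-1)$ with $j\ge1$, $k<r$, $\alpha_r>\alpha_k$. Compare by value, ties broken with $a$ largest, then $c$, then $b$. A type $A$ (resp. $B$) triple is an inversion triple if its entries in increasing order form a cyclic rotation of $(a,c,b)$ (resp. $(c,b,a)$). $\mathrm{InvFree}(\alpha,\sigma)$: fillings with no inversion triples. $\mathrm{maj}(F)=\sum(\mathrm{leg}(b)+1)$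 over non-basement boxes $b$ with $F(a)<F(b)$, $a$ the box immediately left of $b$, $\mathrm{leg}(b)$ the number of boxes to the right of $b$ in its row. Cocharge word: number the non-basement columns $1,2,\dots$ from left to right. Form a two-line array whose top row lists the non-basement entries of $F$ in weakly decreasing order and whose bottom row gives the column of each entry, with column numbers listed in increasing order among equal top entries. $\mathrm{ccw}(F)$ is the bottom row. Cocharge: for a word whose content is a partition, extract standard subwords iteratively: take the rightmost $1$, then scanning leftwards cyclically (wrapping from the left end to the right end) the first $2$, then continuing leftwards cyclically the first $3$, etc., up to the largest letter present; the chosen letters in their order in the word form a permutation $u$; remove them and repeat. For a permutation $u$ of $1,\dots,m$, assign index $0$ to the letter $1$, and for $r<m$ give $r+1$ the index of $r$ plus $1$ if $r+1$ appears to the left of $r$ in $u$, and the same index as $r$ otherwise; $\mathrm{cocharge}(u)$ is the sum of the indices (equivalently $\binom m2-\mathrm{maj}(\mathrm{reverse}(u^{-1}))$). The cocharge of the word is the sum over its standard subwords. *)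

theory Defs
  imports "HOL-Combinatorics.Permutations" "HOL-Library.FuncSet" "HOL-Library.Multiset"
begin

text \<open>
  A sequence \<open>(a\<^sub>1, \<dots>, a\<^sub>n)\<close> is a function on \<open>nat\<close> of which only the values on \<open>{1..n}\<close> matter.
\<close>

definition perm_act :: "(nat \<Rightarrow> nat) \<Rightarrow> (nat \<Rightarrow> 'a) \<Rightarrow> nat \<Rightarrow> 'a" where
  "perm_act \<tau> a = (\<lambda>i. a (inv \<tau> i))"

definition w0 :: "nat \<Rightarrow> nat \<Rightarrow> nat" where
  "w0 n = (\<lambda>i. n + 1 - i)"


subsection \<open>Fillings with big basements\<close>

datatype entry = Num nat | Infty nat

instantiation entry :: linorder
begin

fun less_entry :: "entry \<Rightarrow> entry \<Rightarrow> bool" where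
  "less_entry (Num x) (Num y) \<longleftrightarrow> x < y"
| "less_entry (Num x) (Infty j) \<longleftrightarrow> True"
| "less_entry (Infty i) (Num y) \<longleftrightarrow> False"
| "less_entry (Infty i) (Infty j) \<longleftrightarrow> i < j"

definition less_eq_entry :: "entry \<Rightarrow> entry \<Rightarrow> bool" where
  "less_eq_entry x y \<longleftrightarrow> x < y \<or> x = y"

instance
proof
  fix x y z :: entry
  show "x < y \<longleftrightarrow> x \<le> y \<and> \<not> y \<le> x"
    by (cases x; cases y) (auto simp: less_eq_entry_def)
  show "x \<le> x"
    by (simp add: less_eq_entry_def)
  show "x \<le> y \<Longrightarrow> y \<le> z \<Longrightarrow> x \<le> z"
    by (cases x; cases y; cases z) (auto simp: less_eq_entry_def)
  show "x \<le> y \<Longrightarrow> y \<le> x \<Longrightarrow> x = y"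
    by (cases x; cases y) (auto simp: less_eq_entry_def)
  show "x \<le> y \<or> y \<le> x"
    by (cases x; cases y) (auto simp: less_eq_entry_def)
qed

end

text \<open>The box \<open>(r, j)\<close> lies in row \<open>r\<close>, counted from the top, and in column \<open>j\<close>.\<close>

type_synonym box = "nat \<times> nat"

definition aug_diagram :: "nat \<Rightarrow> (nat \<Rightarrow> nat) \<Rightarrow> box set" where
  "aug_diagram n \<alpha> = {(r, j). r \<in> {1..n} \<and> j \<le> \<alpha> r}"

definition diagram :: "nat \<Rightarrow> (nat \<Rightarrow> nat) \<Rightarrow> box set" where
  "diagram n \<alpha> = {(r, j) \<in> aug_diagram n \<alpha>. j \<ge> 1}"

definition fillings :: "nat \<Rightarrow> (nat \<Rightarrow> nat) \<Rightarrow> (nat \<Rightarrow> nat) \<Rightarrow> (box \<Rightarrow> entry) set" where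
  "fillings n \<alpha> \<sigma> = {F \<in> extensional (aug_diagram n \<alpha>).
     (\<forall>r\<in>{1..n}. F (r, 0) = Infty (\<sigma> r)) \<and>
     (\<forall>b\<in>diagram n \<alpha>. \<exists>m\<ge>1. F b = Num m)}"

definition typeA_triples :: "nat \<Rightarrow> (nat \<Rightarrow> nat) \<Rightarrow> (box \<times> box \<times> box) set" where
  "typeA_triples n \<alpha> = {((r, j - 1), (r, j), (k, j)) | r k j.
     j \<ge> 1 \<and> k > r \<and> \<alpha> r \<ge> \<alpha> k \<and> (r, j) \<in> aug_diagram n \<alpha> \<and> (k, j) \<in> aug_diagram n \<alpha>}"

definition typeB_triples :: "nat \<Rightarrow> (nat \<Rightarrow> nat) \<Rightarrow> (box \<times> box \<times> box) set" where
  "typeB_triples n \<alpha> = {((r, j - 1), (r, j), (k, j - 1)) | r k j.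
     j \<ge> 1 \<and> k < r \<and> \<alpha> r > \<alpha> k \<and> (r, j) \<in> aug_diagram n \<alpha> \<and> (k, j - 1) \<in> aug_diagram n \<alpha>}"

text \<open>
  Entries are compared together with a priority that breaks ties: among equal entries of a
  triple \<open>(a, b, c)\<close>, the one in \<open>a\<close> (priority \<open>2\<close>) is the largest, then that in \<open>c\<close> (priority \<open>1\<close>),
  then that in \<open>b\<close> (priority \<open>0\<close>).
\<close>

fun tie_less :: "entry \<times> nat \<Rightarrow> entry \<times> nat \<Rightarrow> bool" where
  "tie_less (x, p) (y, q) \<longleftrightarrow> x < y \<or> x = y \<and> p < q"

definition inversion_typeA :: "(box \<Rightarrow> entry) \<Rightarrow> box \<times> box \<times> box \<Rightarrow> bool" where
  "inversion_typeA F = (\<lambda>(a, b, c).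
     \<exists>i. sorted_wrt tie_less (rotate i [(F a, 2), (F c, 1), (F b, 0)]))"

definition inversion_typeB :: "(box \<Rightarrow> entry) \<Rightarrow> box \<times> box \<times> box \<Rightarrow> bool" where
  "inversion_typeB F = (\<lambda>(a, b, c).
     \<exists>i. sorted_wrt tie_less (rotate i [(F c, 1), (F b, 0), (F a, 2)]))"

definition inv_free :: "nat \<Rightarrow> (nat \<Rightarrow> nat) \<Rightarrow> (nat \<Rightarrow> nat) \<Rightarrow> (box \<Rightarrow> entry) set" where
  "inv_free n \<alpha> \<sigma> = {F \<in> fillings n \<alpha> \<sigma>.
     (\<forall>t\<in>typeA_triples n \<alpha>. \<not> inversion_typeA F t) \<and>
     (\<forall>t\<in>typeB_triples n \<alpha>. \<not> inversion_typeB F t)}"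

definition leg :: "(nat \<Rightarrow> nat) \<Rightarrow> box \<Rightarrow> nat" where
  "leg \<alpha> = (\<lambda>(r, j). \<alpha> r - j)"

definition maj :: "nat \<Rightarrow> (nat \<Rightarrow> nat) \<Rightarrow> (box \<Rightarrow> entry) \<Rightarrow> nat" where
  "maj n \<alpha> F = (\<Sum>(r, j) \<in> {(r, j) \<in> diagram n \<alpha>. F (r, j - 1) < F (r, j)}. leg \<alpha> (r, j) + 1)"


subsection \<open>Cocharge words\<close>

text \<open>
  The two-line array is the list of its columns. Since \<open>sort_key\<close> is stable, the outer sort keeps
  equal top entries in the order of decreasing bottom entries, and \<open>rev\<close> reverses both orders;
  see the characterization in \<open>two_line_array_unique\<close> below.
\<close>

definition two_line_array :: "nat \<Rightarrow> (nat \<Rightarrow> nat) \<Rightarrow> (box \<Rightarrow> entry) \<Rightarrow> (entry \<times> nat) list" where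
  "two_line_array n \<alpha> F = rev (sort_key fst (rev (sort_key snd
     [(F (r, j), j). r \<leftarrow> [1..<Suc n], j \<leftarrow> [1..<Suc (\<alpha> r)]])))"

definition ccw :: "nat \<Rightarrow> (nat \<Rightarrow> nat) \<Rightarrow> (box \<Rightarrow> entry) \<Rightarrow> nat list" where
  "ccw n \<alpha> F = map snd (two_line_array n \<alpha> F)"

definition array_le :: "entry \<times> nat \<Rightarrow> entry \<times> nat \<Rightarrow> bool" where
  "array_le = (\<lambda>(x, i) (y, j). y < x \<or> x = y \<and> i \<le> j)"

lemma mset_two_line_array:
  "mset (two_line_array n \<alpha> F) = image_mset (\<lambda>(r, j). (F (r, j), j)) (mset_set (diagram n \<alpha>))"
proof -
  let ?bs = "[(r, j). r \<leftarrow> [1..<Suc n], j \<leftarrow> [1..<Suc (\<alpha> r)]]"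
  have set: "set ?bs = diagram n \<alpha>"
    by (simp add: diagram_def aug_diagram_def set_eq_iff image_iff del: upt_Suc) auto
  have "distinct (concat (map (\<lambda>r. map (Pair r) [1..<Suc (\<alpha> r)]) xs))" if "distinct xs" for xs
    using that by (induction xs) (auto simp: distinct_map inj_on_def)
  hence "distinct ?bs"
    by simp
  hence bs: "mset ?bs = mset_set (diagram n \<alpha>)"
    using mset_set_set[of ?bs] set by simp
  have "[(F (r, j), j). r \<leftarrow> [1..<Suc n], j \<leftarrow> [1..<Suc (\<alpha> r)]] = map (\<lambda>(r, j). (F (r, j), j)) ?bs"
    by (simp add: map_concat o_def del: upt_Suc)
  thus ?thesis
    unfolding two_line_array_def by (simp add: bs[symmetric] del: upt_Suc)
qed

lemma sorted_two_line_array: "sorted_wrt array_le (two_line_array n \<alpha> F)"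
proof -
  have "sorted_wrt (\<lambda>p q. fst p < fst q \<or> fst p = fst q \<and> snd q \<le> snd p) (sort_key fst xs)"
    if "sorted_wrt (\<lambda>p q. snd q \<le> snd p) xs" for xs :: "(entry \<times> nat) list"
  proof -
    have ins: "sorted_wrt (\<lambda>p q. fst p < fst q \<or> fst p = fst q \<and> snd q \<le> snd p) (insort_key fst x ys)"
      if "sorted_wrt (\<lambda>p q. fst p < fst q \<or> fst p = fst q \<and> snd q \<le> snd p) ys"
        and "\<forall>y\<in>set ys. snd y \<le> snd x"
      for x and ys :: "(entry \<times> nat) list"
      using that
    proof (induction ys)
      case (Cons y ys)
      show ?case
      proof (cases "fst x \<le> fst y")
        case True
        thus ?thesis
          using Cons.prems by (fastforce simp: le_less)
      next
        case False
        thus ?thesis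
          using Cons by (auto simp: set_insort_key)
      qed
    qed simp
    show ?thesis
      using that by (induction xs) (auto intro!: ins)
  qed
  moreover have "sorted_wrt (\<lambda>p q. snd q \<le> snd p) (rev (sort_key snd xs))"
    for xs :: "(entry \<times> nat) list"
    using sorted_sort_key[of snd xs] by (simp add: sorted_wrt_rev sorted_map)
  ultimately have "sorted_wrt (\<lambda>p q. fst p < fst q \<or> fst p = fst q \<and> snd q \<le> snd p)
      (rev (two_line_array n \<alpha> F))"
    unfolding two_line_array_def by simp
  hence "sorted_wrt (\<lambda>p q. array_le q p) (rev (two_line_array n \<alpha> F))"
    by (rule sorted_wrt_mono_rel[rotated]) (auto simp: array_le_def)
  thus ?thesis
    by (simp add: sorted_wrt_rev)
qed

lemma two_line_array_unique:
  "xs = two_line_array n \<alpha> F \<longleftrightarrow>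
     mset xs = image_mset (\<lambda>(r, j). (F (r, j), j)) (mset_set (diagram n \<alpha>)) \<and>
     sorted_wrt array_le xs"
proof -
  have "xs = ys" if "mset xs = mset ys" "sorted_wrt array_le xs" "sorted_wrt array_le ys" for xs ys
    using that
  proof (induction xs arbitrary: ys)
    case (Cons x xs)
    then obtain y ys' where ys: "ys = y # ys'"
      by (cases ys) auto
    have "x \<in> set ys" "y \<in> set (x # xs)"
      using Cons.prems(1) ys by (metis list.set_intros(1) set_mset_mset)+
    hence "x = y \<or> array_le x y \<and> array_le y x"
      using Cons.prems(2,3) ys by auto
    hence "x = y"
      by (cases x; cases y) (auto simp: array_le_def)
    thus ?case
      using Cons ys by auto
  qed auto
  thus ?thesis
    using mset_two_line_array sorted_two_line_array by metis
qed


subsection \<open>Cocharge\<close>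

text \<open>
  Positions in a word are numbered from \<open>0\<close>. \<open>scan_left w p x\<close> is the position of the first \<open>x\<close>
  met when scanning \<open>w\<close> cyclically leftwards, starting immediately to the left of position \<open>p\<close>;
  it is only meaningful if \<open>x\<close> occurs in \<open>w\<close>.
\<close>

definition scan_left :: "nat list \<Rightarrow> nat \<Rightarrow> nat \<Rightarrow> nat" where
  "scan_left w p x =
     (if \<exists>q<p. w ! q = x then Max {q \<in> {..<p}. w ! q = x}
      else Max {q \<in> {..<length w}. w ! q = x})"

text \<open>
  The position of the letter \<open>i \<ge> 1\<close> of the first standard subword. The scan starts at the right
  end of the word, so that the letter \<open>1\<close> is the rightmost one.
\<close>

primrec std_pos :: "nat list \<Rightarrow> nat \<Rightarrow> nat" where
  "std_pos w 0 = length w"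
| "std_pos w (Suc i) = scan_left w (std_pos w i) (Suc i)"

definition std_positions :: "nat list \<Rightarrow> nat set" where
  "std_positions w = std_pos w ` {1..Max (set w)}"

definition std_subword :: "nat list \<Rightarrow> nat list" where
  "std_subword w = nths w (std_positions w)"

definition std_remainder :: "nat list \<Rightarrow> nat list" where
  "std_remainder w = nths w (- std_positions w)"

definition left_of :: "nat list \<Rightarrow> nat \<Rightarrow> nat \<Rightarrow> bool" where
  "left_of u x y \<longleftrightarrow> (\<exists>q<length u. \<exists>p<q. u ! p = x \<and> u ! q = y)"

text \<open>The index of the letter \<open>r \<ge> 1\<close> of a permutation; the value at \<open>0\<close> is a dummy.\<close>

fun cocharge_index :: "nat list \<Rightarrow> nat \<Rightarrow> nat" where
  "cocharge_index u 0 = 0"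
| "cocharge_index u (Suc 0) = 0"
| "cocharge_index u (Suc (Suc r)) =
     cocharge_index u (Suc r) + (if left_of u (Suc (Suc r)) (Suc r) then 1 else 0)"

definition cocharge_perm :: "nat list \<Rightarrow> nat" where
  "cocharge_perm u = (\<Sum>r = 1..length u. cocharge_index u r)"

lemma length_std_remainder:
  assumes "1 \<in> set w"
  shows "length (std_remainder w) < length w"
proof -
  let ?S = "{q \<in> {..<length w}. w ! q = 1}"
  obtain q where q: "q < length w" "w ! q = 1"
    using assms by (auto simp: in_set_conv_nth)
  hence "Max ?S \<in> ?S"
    by (intro Max_in) auto
  moreover have "std_pos w 1 = Max ?S"
    using q by (auto simp: scan_left_def)
  moreover have "1 \<le> Max (set w)"
    using assms by simp
  ultimately have "std_pos w 1 < length w" "1 \<in> {1..Max (set w)}"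
    by simp_all
  hence "std_pos w 1 < length w" "std_pos w 1 \<in> std_positions w"
    unfolding std_positions_def by blast+
  hence "{i. i < length w \<and> i \<in> - std_positions w} \<subset> {..<length w}"
    by auto
  hence "card {i. i < length w \<and> i \<in> - std_positions w} < card {..<length w}"
    by (rule psubset_card_mono[rotated]) simp
  thus ?thesis
    by (simp add: std_remainder_def length_nths)
qed

text \<open>
  A word whose content is a partition (all letters positive, and each \<open>i + 1\<close> occurring at most
  as often as \<open>i\<close>) contains the letter \<open>1\<close> unless it is empty; removing a standard subword preserves
  this property. The value \<open>0\<close> for other words without a \<open>1\<close> is a dummy.
\<close>

function cocharge :: "nat list \<Rightarrow> nat" where
  "cocharge w = (if 1 \<in> set w then cocharge_perm (std_subword w) + cocharge (std_remainder w) else 0)"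
  by auto
termination
  by (relation "measure length") (auto simp: length_std_remainder)

declare cocharge.simps [simp del]

end

theory Submission
  imports Defs
begin

text \<open>
  Triples of both types are non-inversions exactly when \<open>a, b, c\<close> are cyclically increasing, so
  being inversion-free is a condition on pairs of rows. It determines how to exchange a row with a
  longer row directly below it: from left to right, the long row takes from each column of the pair
  the entry met first when going upwards cyclically from its previous entry. This keeps the content
  of every column, the major index and the conditions with all other rows. Hence a longest row can
  be moved to the top. There it meets in each column the first entry, among all rows, after its
  previous one; so it is the first standard subword of the cocharge word, its ascents are the places
  where the cocharge index increases, and the theorem follows by induction on the number of rows.
\<close>

subsection \<open>Cyclic order\<close>

text \<open>
  For fixed \<open>a\<close>, the linear order that starts just above \<open>a\<close> and wraps around, so that \<open>a\<close> is its
  greatest element.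
\<close>

definition cyc_le :: "'a::linorder \<Rightarrow> 'a \<Rightarrow> 'a \<Rightarrow> bool" where
  "cyc_le a b c \<longleftrightarrow> a < b \<and> b \<le> c \<or> b \<le> c \<and> c \<le> a \<or> c \<le> a \<and> a < b"

lemma cyc_le_refl [simp]: "cyc_le a b b"
  by (auto simp: cyc_le_def)

lemma cyc_le_base [simp]: "cyc_le a b a"
  by (auto simp: cyc_le_def)

lemma cyc_le_total: "cyc_le a b c \<or> cyc_le a c b"
  by (auto simp: cyc_le_def)

lemma cyc_le_trans: "cyc_le a b c \<Longrightarrow> cyc_le a c d \<Longrightarrow> cyc_le a b d"
  by (auto simp: cyc_le_def)

lemma cyc_le_rebase: "cyc_le a b d \<Longrightarrow> cyc_le d b c \<longleftrightarrow> cyc_le a b c \<and> cyc_le a c d"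
  by (auto simp: cyc_le_def)

lemma cyc_le_advance: "cyc_le a b c \<Longrightarrow> cyc_le a c d \<Longrightarrow> cyc_le d b c"
  using cyc_le_trans cyc_le_rebase by blast

lemma cyc_le_skip:
  assumes "\<not> cyc_le u b a" "cyc_le u b c" "cyc_le c d a"
  shows "cyc_le c d b" "cyc_le b d a"
proof -
  have "cyc_le u a b"
    using assms(1) cyc_le_total by blast
  then have "cyc_le c a b"
    using assms(2) by (rule cyc_le_advance)
  with assms(3) show "cyc_le c d b" "cyc_le b d a"
    by (rule cyc_le_trans, rule cyc_le_advance)
qed

lemma cyc_le_swap_targets:
  assumes "cyc_le y X x" "cyc_le y Y x" "cyc_le x X c" "cyc_le y Y c"
  shows "cyc_le y X c" "cyc_le x Y c"
  using assms by (simp_all add: cyc_le_rebase)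

definition asc :: "'a::linorder \<Rightarrow> 'a \<Rightarrow> nat" where
  "asc a b = of_bool (a < b)"

lemma asc_refl [simp]: "asc a a = 0"
  by (simp add: asc_def)

text \<open>Both routes from \<open>y\<close> to \<open>U\<close> go around the cycle equally often.\<close>

lemma asc_reroute:
  assumes "cyc_le y Y u" "cyc_le u U Y"
  shows "asc y u + asc u U = asc y Y + asc Y U"
  using assms by (auto simp: asc_def cyc_le_def)

lemma asc_swap_targets:
  assumes "cyc_le y X x" "cyc_le y Y x"
  shows "asc y X + asc x Y = asc x X + asc y Y"
  using asc_reroute[OF assms(1), of X] asc_reroute[OF assms(2), of Y] by simp

primrec ascents :: "(nat \<Rightarrow> 'a::linorder) \<Rightarrow> nat \<Rightarrow> nat" where
  "ascents f 0 = 0"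
| "ascents f (Suc r) = ascents f r + asc (f r) (f (Suc r))"


subsection \<open>Rows\<close>

text \<open>The row \<open>(p, x)\<close> has entries \<open>x 1, \<dots>, x p\<close> and basement entry \<open>x 0\<close>.\<close>

type_synonym 'a row = "nat \<times> (nat \<Rightarrow> 'a)"

definition avoids :: "nat \<Rightarrow> (nat \<Rightarrow> 'a::linorder) \<Rightarrow> (nat \<Rightarrow> 'a) \<Rightarrow> bool" where
  "avoids m x z \<longleftrightarrow> (\<forall>j<m. cyc_le (x j) (x (Suc j)) (z j))"

lemma avoidsI: "(\<And>j. j < m \<Longrightarrow> cyc_le (x j) (x (Suc j)) (z j)) \<Longrightarrow> avoids m x z"
  by (simp add: avoids_def)

lemma avoidsD: "avoids m x z \<Longrightarrow> j < m \<Longrightarrow> cyc_le (x j) (x (Suc j)) (z j)"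
  by (simp add: avoids_def)

text \<open>The first argument is the upper row; the two cases are the triples of type A and type B.\<close>

fun inv_free_pair :: "'a::linorder row \<Rightarrow> 'a row \<Rightarrow> bool" where
  "inv_free_pair (p, x) (q, y) \<longleftrightarrow>
     (if q \<le> p then avoids q x (y \<circ> Suc) else avoids (Suc p) y x)"

fun cells :: "'a row \<Rightarrow> ('a \<times> nat) multiset" where
  "cells (p, x) = (\<Sum>j = 1..p. {#(x j, j)#})"

fun row_maj :: "'a::linorder row \<Rightarrow> nat" where
  "row_maj (p, x) = (\<Sum>r = 1..p. ascents x r)"

fun row_bounded :: "'a::linorder \<Rightarrow> 'a row \<Rightarrow> bool" where
  "row_bounded t (p, x) \<longleftrightarrow> x 0 = t \<and> (\<forall>j\<le>p. x j \<le> t)"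


subsection \<open>Exchanging two rows\<close>

text \<open>The exchange of a row \<open>x\<close> of length \<open>p\<close> with a longer row \<open>y\<close> directly below it.\<close>

primrec long_row :: "nat \<Rightarrow> (nat \<Rightarrow> 'a::linorder) \<Rightarrow> (nat \<Rightarrow> 'a) \<Rightarrow> nat \<Rightarrow> 'a" where
  "long_row p x y 0 = y 0"
| "long_row p x y (Suc j) =
     (if j < p \<and> \<not> cyc_le (long_row p x y j) (y (Suc j)) (x (Suc j)) then x (Suc j) else y (Suc j))"

definition short_row :: "nat \<Rightarrow> (nat \<Rightarrow> 'a::linorder) \<Rightarrow> (nat \<Rightarrow> 'a) \<Rightarrow> nat \<Rightarrow> 'a" where
  "short_row p x y j = (if long_row p x y j = y j then x j else y j)"

lemma long_row_cases:
  obtains (straight) "long_row p x y j = y j" "short_row p x y j = x j"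
  | (crossed) "j \<le> p" "long_row p x y j \<noteq> y j" "long_row p x y j = x j" "short_row p x y j = y j"
proof (cases "long_row p x y j = y j")
  case False
  then have "j \<le> p \<and> long_row p x y j = x j"
    by (cases j) (auto split: if_splits)
  with False that show thesis
    by (simp add: short_row_def)
qed (use that in \<open>simp add: short_row_def\<close>)

lemma long_row_eq_lower: "p < j \<Longrightarrow> long_row p x y j = y j"
  by (cases j) auto

lemma long_row_le_lower: "cyc_le (long_row p x y j) (long_row p x y (Suc j)) (y (Suc j))"
  using cyc_le_total by auto

lemma long_row_crossed:
  assumes "long_row p x y (Suc j) \<noteq> y (Suc j)"
  shows "\<not> cyc_le (long_row p x y j) (y (Suc j)) (x (Suc j))"
  using assms by (auto split: if_splits)

lemma long_row_avoids_short_row: "avoids p (long_row p x y) (short_row p x y \<circ> Suc)"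
proof (rule avoidsI)
  fix j
  assume "j < p"
  then show "cyc_le (long_row p x y j) (long_row p x y (Suc j)) ((short_row p x y \<circ> Suc) j)"
    using cyc_le_total by (auto simp: short_row_def)
qed

lemma sum_exchange:
  fixes g h g' h' :: "nat \<Rightarrow> 'a::comm_monoid_add"
  assumes "p \<le> q" "\<And>j. j \<le> p \<Longrightarrow> g j + h j = g' j + h' j" "\<And>j. p < j \<Longrightarrow> g j = h' j"
  shows "sum g {1..q} + sum h {1..p} = sum g' {1..p} + sum h' {1..q}"
proof -
  have split: "sum f {1..q} = sum f {1..p} + sum f {Suc p..q}" for f :: "nat \<Rightarrow> 'a"
    using assms(1) sum.ub_add_nat[of 1 p f "q - p"] by simp
  have "sum g {1..q} + sum h {1..p} = (\<Sum>j = 1..p. g j + h j) + sum g {Suc p..q}"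
    unfolding split sum.distrib by (simp add: ac_simps)
  also have "\<dots> = (\<Sum>j = 1..p. g' j + h' j) + sum h' {Suc p..q}"
    using assms(2,3) by simp
  also have "\<dots> = sum g' {1..p} + sum h' {1..q}"
    unfolding split sum.distrib by (simp add: ac_simps)
  finally show ?thesis .
qed

lemma cells_exchange:
  assumes "p < q"
  shows "cells (q, long_row p x y) + cells (p, short_row p x y) = cells (p, x) + cells (q, y)"
  unfolding cells.simps
proof (rule sum_exchange)
  fix j
  show "{#(long_row p x y j, j)#} + {#(short_row p x y j, j)#} = {#(x j, j)#} + {#(y j, j)#}"
    by (cases rule: long_row_cases[of p x y j]) auto
qed (use assms in \<open>simp_all add: long_row_eq_lower\<close>)

lemma exchange_all:
  assumes "\<And>j. j \<le> p \<Longrightarrow> P j (x j)" "\<And>j. j \<le> q \<Longrightarrow> P j (y j)" "p \<le> q"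
  shows "j \<le> q \<Longrightarrow> P j (long_row p x y j)" "j \<le> p \<Longrightarrow> P j (short_row p x y j)"
  using assms by (cases rule: long_row_cases[of p x y j]; simp)+

lemma row_bounded_exchange:
  assumes "row_bounded t (p, x)" "row_bounded t (q, y)" "p < q"
  shows "row_bounded t (q, long_row p x y)" "row_bounded t (p, short_row p x y)"
  using assms exchange_all[of p "\<lambda>_ a. a \<le> t" x q y] by (auto simp: short_row_def)

context
  fixes p :: nat and x y :: "nat \<Rightarrow> 'a::linorder"
  assumes y_avoids_x: "avoids (Suc p) y x"
begin

lemma lower_le_long_row: "cyc_le (y j) (y (Suc j)) (long_row p x y j)"
  using avoidsD[OF y_avoids_x, of j] by (cases rule: long_row_cases[of p x y j]) auto

lemma crossing_targets:
  assumes "j < p" "long_row p x y j = y j \<longleftrightarrow> long_row p x y (Suc j) \<noteq> y (Suc j)"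
  shows "cyc_le (y j) (x (Suc j)) (x j)"
proof (cases "long_row p x y j = y j")
  case True
  then have "cyc_le (y j) (x (Suc j)) (y (Suc j))"
    using assms cyc_le_total long_row_crossed by metis
  then show ?thesis
    using avoidsD[OF y_avoids_x, of j] assms(1) cyc_le_trans by auto
next
  case False
  then have "long_row p x y j = x j"
    by (cases rule: long_row_cases[of p x y j]) auto
  then have "cyc_le (x j) (y (Suc j)) (x (Suc j))"
    using False assms by (auto split: if_splits)
  then show ?thesis
    using avoidsD[OF y_avoids_x, of j] assms(1) cyc_le_rebase by auto
qed

lemma asc_exchange:
  assumes "j < p"
  shows "asc (long_row p x y j) (long_row p x y (Suc j))
      + asc (short_row p x y j) (short_row p x y (Suc j))
    = asc (x j) (x (Suc j)) + asc (y j) (y (Suc j))"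
proof -
  note swap = asc_swap_targets[OF crossing_targets[OF assms]
      avoidsD[OF y_avoids_x less_SucI[OF assms]]]
  show ?thesis
    by (cases rule: long_row_cases[of p x y j]; cases rule: long_row_cases[of p x y "Suc j"])
      (use swap in \<open>simp_all del: long_row.simps\<close>)
qed

lemma cyc_le_exchange:
  assumes "j < p" "cyc_le (x j) (x (Suc j)) c" "cyc_le (y j) (y (Suc j)) c"
  shows "cyc_le (long_row p x y j) (long_row p x y (Suc j)) c"
    and "cyc_le (short_row p x y j) (short_row p x y (Suc j)) c"
proof -
  note swap = cyc_le_swap_targets[OF crossing_targets[OF assms(1)]
      avoidsD[OF y_avoids_x less_SucI[OF assms(1)]] assms(2,3)]
  show "cyc_le (long_row p x y j) (long_row p x y (Suc j)) c"
    "cyc_le (short_row p x y j) (short_row p x y (Suc j)) c"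
    by ((cases rule: long_row_cases[of p x y j]; cases rule: long_row_cases[of p x y "Suc j"]),
        use swap assms in \<open>simp_all del: long_row.simps\<close>)+
qed

lemma ascents_long_row: "ascents (long_row p x y) r = ascents y r + asc (y r) (long_row p x y r)"
proof (induction r)
  case (Suc r)
  from asc_reroute[OF lower_le_long_row long_row_le_lower, of r] Suc show ?case
    by (simp del: long_row.simps)
qed simp

lemma ascents_exchange:
  "r \<le> p \<Longrightarrow> ascents (long_row p x y) r + ascents (short_row p x y) r = ascents x r + ascents y r"
proof (induction r)
  case (Suc r)
  with asc_exchange[of r] show ?case
    by (simp del: long_row.simps)
qed simp

lemma row_maj_exchange:
  assumes "p < q"
  shows "row_maj (q, long_row p x y) + row_maj (p, short_row p x y)
    = row_maj (p, x) + row_maj (q, y)"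
  unfolding row_maj.simps
  by (rule sum_exchange)
    (use assms in \<open>simp_all add: ascents_exchange,
      simp_all add: ascents_long_row long_row_eq_lower\<close>)

lemma exchange_avoids:
  assumes "avoids m x c" "avoids m y c" "m \<le> p"
  shows "avoids m (long_row p x y) c" "avoids m (short_row p x y) c"
  using assms cyc_le_exchange unfolding avoids_def by auto

lemma lower_le_third:
  assumes y_avoids_z: "avoids m y z" and z_avoids_x: "avoids p z (x \<circ> Suc)"
    and "p < m" "j < m"
  shows "cyc_le (long_row p x y j) (y (Suc j)) (z j)"
  using \<open>j < m\<close>
proof (induction j)
  case 0
  with avoidsD[OF y_avoids_z, of 0] show ?case
    by simp
next
  case (Suc j)
  let ?j' = "Suc j"
  show ?case
  proof (cases rule: long_row_cases[of p x y ?j'])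
    case straight
    with avoidsD[OF y_avoids_z \<open>?j' < m\<close>] show ?thesis
      by simp
  next
    case crossed
    have "cyc_le (z j) (z ?j') (x ?j')"
      using avoidsD[OF z_avoids_x, of j] crossed(1) by simp
    then have "cyc_le (y ?j') (z ?j') (x ?j')"
      using Suc long_row_crossed[OF crossed(2)] cyc_le_skip(2) by (meson Suc_lessD)
    with avoidsD[OF y_avoids_z \<open>?j' < m\<close>] have "cyc_le (x ?j') (y (Suc ?j')) (z ?j')"
      by (rule cyc_le_advance)
    with crossed(3) show ?thesis
      by simp
  qed
qed

lemma long_row_avoids:
  assumes y_avoids_z: "avoids m y z" and z_avoids_x: "avoids p z (x \<circ> Suc)" and "p < m"
  shows "avoids m (long_row p x y) z" "avoids p z (short_row p x y \<circ> Suc)"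
proof -
  note not_passed = lower_le_third[OF assms]
  show "avoids m (long_row p x y) z"
    by (intro avoidsI cyc_le_trans[OF long_row_le_lower] not_passed)
  show "avoids p z (short_row p x y \<circ> Suc)"
  proof (rule avoidsI)
    fix j
    assume "j < p"
    then have z_x: "cyc_le (z j) (z (Suc j)) (x (Suc j))"
      using avoidsD[OF z_avoids_x] by simp
    show "cyc_le (z j) (z (Suc j)) ((short_row p x y \<circ> Suc) j)"
    proof (cases rule: long_row_cases[of p x y "Suc j"])
      case straight
      with z_x show ?thesis
        by simp
    next
      case crossed
      with cyc_le_skip(1)[OF long_row_crossed[OF crossed(2)] not_passed z_x] \<open>j < p\<close> \<open>p < m\<close>
      show ?thesis
        by simp
    qed
  qed
qed

end

lemma inv_free_pair_exchange:
  assumes "p < q"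
  shows "inv_free_pair (q, long_row p x y) (p, short_row p x y)"
  using assms long_row_avoids_short_row by simp

lemma inv_free_pair_exchange_above:
  assumes "p < q" "inv_free_pair (p, x) (q, y)"
    and z: "inv_free_pair (l, z) (p, x)" "inv_free_pair (l, z) (q, y)"
  shows "inv_free_pair (l, z) (q, long_row p x y)" "inv_free_pair (l, z) (p, short_row p x y)"
proof -
  let ?u = "long_row p x y" and ?v = "short_row p x y"
  have y_avoids_x: "avoids (Suc p) y x"
    using assms by simp
  consider (z_longest) "q \<le> l" | (z_shortest) "l < p" | (z_middle) "p \<le> l" "l < q"
    by linarith
  then have "inv_free_pair (l, z) (q, ?u) \<and> inv_free_pair (l, z) (p, ?v)"
  proof cases
    case z_longest
    then have "avoids p z (x \<circ> Suc)" "avoids q z (y \<circ> Suc)"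
      using z \<open>p < q\<close> by simp_all
    then have "avoids q z (?u \<circ> Suc)" "avoids p z (?v \<circ> Suc)"
      using \<open>p < q\<close> by (auto simp: avoids_def short_row_def)
    with z_longest \<open>p < q\<close> show ?thesis
      by simp
  next
    case z_shortest
    then show ?thesis
      using z \<open>p < q\<close> exchange_avoids[OF y_avoids_x, of "Suc l" z] by simp
  next
    case z_middle
    then show ?thesis
      using z long_row_avoids[OF y_avoids_x, of "Suc l" z] by simp
  qed
  then show "inv_free_pair (l, z) (q, ?u)" "inv_free_pair (l, z) (p, ?v)"
    by blast+
qed

text \<open>The case \<open>z_middle\<close> is that of the previous lemma with \<open>z\<close> shifted by one column.\<close>

lemma inv_free_pair_exchange_below:
  assumes "p < q" "inv_free_pair (p, x) (q, y)"
    and z: "inv_free_pair (p, x) (l, z)" "inv_free_pair (q, y) (l, z)"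
  shows "inv_free_pair (q, long_row p x y) (l, z)" "inv_free_pair (p, short_row p x y) (l, z)"
proof -
  let ?u = "long_row p x y" and ?v = "short_row p x y"
  have y_avoids_x: "avoids (Suc p) y x"
    using assms by simp
  consider (z_longest) "q < l" | (z_shortest) "l \<le> p" | (z_middle) "p < l" "l \<le> q"
    by linarith
  then have "inv_free_pair (q, ?u) (l, z) \<and> inv_free_pair (p, ?v) (l, z)"
  proof cases
    case z_longest
    then have "avoids (Suc p) z x" "avoids (Suc q) z y"
      using z \<open>p < q\<close> by simp_all
    then have "avoids (Suc q) z ?u" "avoids (Suc p) z ?v"
      using \<open>p < q\<close> exchange_all[of p "\<lambda>j. cyc_le (z j) (z (Suc j))" x q y]
      by (auto simp: avoids_def less_Suc_eq_le)
    with z_longest \<open>p < q\<close> show ?thesis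
      by simp
  next
    case z_shortest
    then show ?thesis
      using z \<open>p < q\<close> exchange_avoids[OF y_avoids_x, of l "z \<circ> Suc"] by simp
  next
    case z_middle
    then have z_avoids_x: "avoids (Suc p) z x" and y_avoids_z: "avoids l y (z \<circ> Suc)"
      using z by simp_all
    have "avoids p (z \<circ> Suc) (x \<circ> Suc)"
      using z_avoids_x by (simp add: avoids_def)
    note avoid = long_row_avoids[OF y_avoids_x y_avoids_z this \<open>p < l\<close>]
    have "cyc_le (z 0) (z 1) (?v 0)"
      using avoidsD[OF z_avoids_x, of 0] by (simp add: short_row_def)
    with avoid(2) have "avoids (Suc p) z ?v"
      by (auto simp: avoids_def less_Suc_eq_0_disj)
    with z_middle avoid(1) show ?thesis
      by simp
  qed
  then show "inv_free_pair (q, ?u) (l, z)" "inv_free_pair (p, ?v) (l, z)"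
    by blast+
qed


subsection \<open>Moving a longest row to the top\<close>

definition inv_free_rows :: "'a::linorder \<Rightarrow> 'a row list \<Rightarrow> bool" where
  "inv_free_rows t rs \<longleftrightarrow> sorted_wrt inv_free_pair rs \<and> (\<forall>R\<in>set rs. row_bounded t R)"

definition same_statistics :: "'a::linorder row list \<Rightarrow> 'a row list \<Rightarrow> bool" where
  "same_statistics rs rs' \<longleftrightarrow>
     mset (map fst rs) = mset (map fst rs') \<and>
     sum_list (map cells rs) = sum_list (map cells rs') \<and>
     sum_list (map row_maj rs) = sum_list (map row_maj rs')"

lemma same_statistics_trans:
  "same_statistics rs rs' \<Longrightarrow> same_statistics rs' rs'' \<Longrightarrow> same_statistics rs rs''"
  by (simp add: same_statistics_def)

lemma inv_free_rows_exchange: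
  assumes "inv_free_rows t (us @ (p, x) # (q, y) # vs)" "p < q"
  shows "inv_free_rows t (us @ (q, long_row p x y) # (p, short_row p x y) # vs)"
proof -
  have sorted: "sorted_wrt inv_free_pair (us @ (p, x) # (q, y) # vs)"
    and bounded: "\<forall>R\<in>set (us @ (p, x) # (q, y) # vs). row_bounded t R"
    using assms(1) unfolding inv_free_rows_def by blast+
  have pair: "inv_free_pair (p, x) (q, y)"
    using sorted by (simp add: sorted_wrt_append del: inv_free_pair.simps)
  have "inv_free_pair S (q, long_row p x y) \<and> inv_free_pair S (p, short_row p x y)"
    if "S \<in> set us" for S
    using sorted that inv_free_pair_exchange_above[OF \<open>p < q\<close> pair]
    by (cases S) (simp add: sorted_wrt_append del: inv_free_pair.simps)
  moreover have "inv_free_pair (q, long_row p x y) S \<and> inv_free_pair (p, short_row p x y) S"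
    if "S \<in> set vs" for S
    using sorted that inv_free_pair_exchange_below[OF \<open>p < q\<close> pair]
    by (cases S) (simp add: sorted_wrt_append del: inv_free_pair.simps)
  ultimately have "sorted_wrt inv_free_pair (us @ (q, long_row p x y) # (p, short_row p x y) # vs)"
    using sorted inv_free_pair_exchange[OF \<open>p < q\<close>, of x y]
    by (auto simp: sorted_wrt_append simp del: inv_free_pair.simps)
  moreover have "\<forall>R\<in>set (us @ (q, long_row p x y) # (p, short_row p x y) # vs). row_bounded t R"
    using bounded row_bounded_exchange[OF _ _ \<open>p < q\<close>, of t x y]
    by (auto simp del: row_bounded.simps)
  ultimately show ?thesis
    by (simp only: inv_free_rows_def)
qed

lemma same_statistics_exchange:
  assumes "inv_free_pair (p, x) (q, y)" "p < q"
  shows "same_statistics (us @ (q, long_row p x y) # (p, short_row p x y) # vs)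
    (us @ (p, x) # (q, y) # vs)"
proof -
  have "cells (q, long_row p x y) + (cells (p, short_row p x y) + M)
      = cells (p, x) + (cells (q, y) + M)" for M
    unfolding add.assoc[symmetric] cells_exchange[OF \<open>p < q\<close>] ..
  moreover have y_avoids_x: "avoids (Suc p) y x"
    using assms by simp
  have "row_maj (q, long_row p x y) + (row_maj (p, short_row p x y) + k)
      = row_maj (p, x) + (row_maj (q, y) + k)" for k
    unfolding add.assoc[symmetric] row_maj_exchange[OF y_avoids_x \<open>p < q\<close>] ..
  ultimately show ?thesis
    by (simp add: same_statistics_def del: cells.simps row_maj.simps)
qed

lemma move_above_shorter_rows:
  assumes "inv_free_rows t (us @ R # vs)" "\<forall>S\<in>set us. fst S < fst R"
  shows "\<exists>f rs. inv_free_rows t ((fst R, f) # rs) \<and> same_statistics ((fst R, f) # rs) (us @ R # vs)"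
  using assms
proof (induction us arbitrary: R vs rule: rev_induct)
  case Nil
  then show ?case
    by (intro exI[of _ "snd R"] exI[of _ vs]) (simp add: same_statistics_def)
next
  case (snoc S us)
  obtain p x q y where S: "S = (p, x)" and R: "R = (q, y)"
    by (cases S; cases R)
  have "p < q" and rows: "inv_free_rows t (us @ (p, x) # (q, y) # vs)"
    using snoc.prems by (simp_all add: S R)
  have "inv_free_pair (p, x) (q, y)"
    using rows by (simp add: inv_free_rows_def sorted_wrt_append)
  note statistics = same_statistics_exchange[OF this \<open>p < q\<close>, of us vs]
  have "\<forall>S\<in>set us. fst S < fst (q, long_row p x y)"
    using snoc.prems(2) by (simp add: R)
  from snoc.IH[OF inv_free_rows_exchange[OF rows \<open>p < q\<close>] this]
  obtain f rs where "inv_free_rows t ((q, f) # rs)"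
    "same_statistics ((q, f) # rs) (us @ (q, long_row p x y) # (p, short_row p x y) # vs)"
    by auto
  then show ?case
    using same_statistics_trans[OF _ statistics] by (auto simp: S R)
qed

lemma longest_row_first:
  assumes "inv_free_rows t rs" "rs \<noteq> []"
  obtains m f rs' where "inv_free_rows t ((m, f) # rs')" "same_statistics ((m, f) # rs') rs"
    "\<forall>S\<in>set rs'. fst S \<le> m"
proof -
  define m where "m = Max (fst ` set rs)"
  have "m \<in> fst ` set rs"
    unfolding m_def using assms(2) by (intro Max_in) simp_all
  then have "\<exists>R\<in>set rs. fst R = m"
    by blast
  then obtain us R vs where rs: "rs = us @ R # vs" "fst R = m" "\<forall>S\<in>set us. fst S \<noteq> m"
    by (rule split_list_first_propE)
  have le: "fst S \<le> m" if "S \<in> set rs" for S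
    using that by (simp add: m_def)
  then have "\<forall>S\<in>set us. fst S < fst R"
    using rs by (auto intro!: le_neq_trans)
  then obtain f rs' where rs': "inv_free_rows t ((m, f) # rs')" "same_statistics ((m, f) # rs') rs"
    using move_above_shorter_rows assms(1) rs by blast
  then have "fst ` set ((m, f) # rs') = fst ` set rs"
    unfolding same_statistics_def by (metis image_set set_mset_mset)
  with le have "\<forall>S\<in>set rs'. fst S \<le> m"
    by (metis image_iff list.set_intros(2))
  with rs' that show thesis
    by blast
qed


subsection \<open>Standard subwords\<close>

lemma nths_conv_map_nth: "nths xs I = map ((!) xs) (filter (\<lambda>i. i \<in> I) [0..<length xs])"
proof (induction xs rule: rev_induct)
  case (snoc x xs)
  have "map ((!) (xs @ [x])) (filter (\<lambda>i. i \<in> I) [0..<length xs])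
      = map ((!) xs) (filter (\<lambda>i. i \<in> I) [0..<length xs])"
    by (auto simp: nth_append)
  with snoc show ?case
    by (simp add: nths_append)
qed simp

lemma mset_nths: "mset (nths xs I) = image_mset ((!) xs) (mset_set {i. i < length xs \<and> i \<in> I})"
proof -
  have "mset (filter (\<lambda>i. i \<in> I) [0..<length xs]) = mset_set {i. i < length xs \<and> i \<in> I}"
    by (subst mset_set_set[symmetric]) (auto intro: arg_cong[of _ _ mset_set])
  then show ?thesis
    by (simp add: nths_conv_map_nth)
qed

lemma mset_nths_Compl: "mset (nths xs I) + mset (nths xs (- I)) = mset xs"
proof -
  have "mset xs = image_mset ((!) xs) (mset [0..<length xs])"
    by (metis map_nth mset_map)
  also have "\<dots> = mset (nths xs I) + mset (nths xs (- I))"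
    by (subst multiset_partition[of _ "\<lambda>i. i \<in> I"]) (simp add: nths_conv_map_nth)
  finally show ?thesis ..
qed

lemma sorted_wrt_nths: "sorted_wrt P xs \<Longrightarrow> sorted_wrt P (nths xs I)"
  by (induction xs arbitrary: I) (auto simp: nths_Cons dest: in_set_nthsD)

lemma cells_conv_image_mset: "cells (p, x) = image_mset (\<lambda>j. (x j, j)) (mset_set {1..p})"
  by (simp add: sum_unfold_sum_mset)

lemma array_nth_less_iff:
  assumes "sorted_wrt array_le L" "p < length L" "q < length L"
    and "L ! p = (b, k)" "L ! q = (a, i)" "i < k"
  shows "p < q \<longleftrightarrow> a < b"
proof -
  consider "p < q" | "q < p"
    using assms by (metis Pair_inject less_irrefl nat_neq_iff)
  then show ?thesis
    using sorted_wrt_nth_less[OF assms(1), of p q] sorted_wrt_nth_less[OF assms(1), of q p] assms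
    by cases (auto simp: array_le_def)
qed

lemma left_of_array_iff:
  assumes "sorted_wrt array_le L" "distinct (map snd L)" "(b, k) \<in> set L" "(a, i) \<in> set L" "i < k"
  shows "left_of (map snd L) k i \<longleftrightarrow> a < b"
proof -
  obtain p q where p: "p < length L" "L ! p = (b, k)" and q: "q < length L" "L ! q = (a, i)"
    using assms(3,4) by (metis in_set_conv_nth)
  have unique: "p' = p" "q' = q"
    if "p' < q'" "q' < length L" "map snd L ! p' = k" "map snd L ! q' = i" for p' q'
    using nth_eq_iff_index_eq[OF assms(2), of p' p] nth_eq_iff_index_eq[OF assms(2), of q' q]
      p q that by simp_all
  have "left_of (map snd L) k i \<longleftrightarrow> p < q"
  proof
    assume "left_of (map snd L) k i"
    then show "p < q"
      unfolding left_of_def length_map using unique by blast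
  next
    assume "p < q"
    then show "left_of (map snd L) k i"
      unfolding left_of_def using p q by (intro exI[of _ q] conjI exI[of _ p]) simp_all
  qed
  then show ?thesis
    using array_nth_less_iff assms(1,5) p q by blast
qed

lemma cocharge_perm_eq_row_maj:
  assumes sorted: "sorted_wrt array_le L" and L: "mset L = cells (m, f)"
    and "m \<ge> 1 \<Longrightarrow> f 1 \<le> f 0"
  shows "cocharge_perm (map snd L) = row_maj (m, f)"
proof -
  have columns: "mset (map snd L) = mset_set {1..m}"
    by (simp add: L cells_conv_image_mset image_mset.compositionality o_def del: cells.simps)
  then have "distinct (map snd L)"
    using mset_eq_imp_distinct_iff[of "map snd L" "[1..<Suc m]"]
    by (simp add: atLeastLessThanSuc_atLeastAtMost del: upt_Suc)
  have entry: "(f j, j) \<in> set L" if "1 \<le> j" "j \<le> m" for j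
  proof -
    have "(f j, j) \<in># mset L"
      using that by (simp add: L cells_conv_image_mset del: cells.simps)
    then show ?thesis
      by simp
  qed
  have index: "cocharge_index (map snd L) r = ascents f r" if "r \<le> m" for r
    using that
  proof (induction "map snd L" r rule: cocharge_index.induct)
    case 2
    with assms(3) show ?case
      by (simp add: asc_def)
  next
    case (3 r)
    then have "left_of (map snd L) (Suc (Suc r)) (Suc r) \<longleftrightarrow> f (Suc r) < f (Suc (Suc r))"
      using left_of_array_iff[OF sorted \<open>distinct (map snd L)\<close> entry entry, of _ "Suc r"] by simp
    with 3 show ?case
      by (simp add: asc_def)
  qed simp
  have "length (map snd L) = m"
    using columns by (metis card_atLeastAtMost diff_Suc_1 size_mset size_mset_set)
  then show ?thesis
    using index by (simp add: cocharge_perm_def)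
qed

lemma nth_Max_sorted:
  assumes "sorted_wrt array_le L" "Q \<subseteq> {..<length L}" "q \<in> Q" "L ! q = (v, k)"
    and least: "\<And>q'. q' \<in> Q \<Longrightarrow> snd (L ! q') = k \<and> v \<le> fst (L ! q')"
  shows "Max Q < length L \<and> L ! Max Q = (v, k)"
proof -
  have "finite Q"
    using assms(2) finite_subset by blast
  with assms(3) have Max: "Max Q \<in> Q" "q \<le> Max Q"
    by (auto intro: Max_in)
  then have "Max Q < length L"
    using assms(2) by blast
  moreover have "q = Max Q \<or> array_le (v, k) (L ! Max Q)"
    using sorted_wrt_nth_less[OF assms(1) _ \<open>Max Q < length L\<close>, of q] Max(2) assms(4)
    by (auto simp: le_less)
  then have "L ! Max Q = (v, k)"
    using least[OF Max(1)] assms(4) by (cases "L ! Max Q") (auto simp: array_le_def)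
  ultimately show ?thesis ..
qed

lemma scan_left_eq_Max:
  assumes first: "(v, k) \<in> set L" "\<And>c. (c, k) \<in> set L \<Longrightarrow> cyc_le a v c"
    and p: "p \<le> length L" "\<And>q. q < length L \<Longrightarrow> snd (L ! q) = k \<Longrightarrow> q < p \<longleftrightarrow> a < fst (L ! q)"
  shows "scan_left (map snd L) p k
    = Max {q. q < length L \<and> snd (L ! q) = k \<and> (a < v \<longrightarrow> a < fst (L ! q))}" (is "_ = Max ?Q")
proof (cases "a < v")
  case True
  obtain q where "q < length L" "L ! q = (v, k)"
    using first(1) by (metis in_set_conv_nth)
  then have "\<exists>q<p. map snd L ! q = k"
    using True p by (intro exI[of _ q]) simp
  moreover have "q < p \<and> map snd L ! q = k \<longleftrightarrow> q \<in> ?Q" for q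
    using True p(1) p(2)[of q] by (cases "q < length L") auto
  then have "{q \<in> {..<p}. map snd L ! q = k} = ?Q"
    by blast
  ultimately show ?thesis
    by (simp add: scan_left_def)
next
  case False
  have "\<not> (\<exists>q<p. map snd L ! q = k)"
  proof
    assume "\<exists>q<p. map snd L ! q = k"
    then obtain q where q: "q < length L" "q < p" "snd (L ! q) = k"
      using p(1) by auto
    then have "(fst (L ! q), k) \<in> set L"
      by (metis nth_mem prod.collapse)
    with first(2) p(2) q False show False
      by (fastforce simp: cyc_le_def)
  qed
  moreover have "{q \<in> {..<length (map snd L)}. map snd L ! q = k} = ?Q"
    using False by auto
  ultimately show ?thesis
    by (simp only: scan_left_def if_False)
qed

text \<open>
  Scanning to the left goes up in the top row of the array, so the cyclically first entry of a
  column is met first.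
\<close>

lemma scan_left_array:
  assumes sorted: "sorted_wrt array_le L"
    and first: "(v, k) \<in> set L" "\<And>c. (c, k) \<in> set L \<Longrightarrow> cyc_le a v c"
    and p: "p \<le> length L" "\<And>q. q < length L \<Longrightarrow> snd (L ! q) = k \<Longrightarrow> q < p \<longleftrightarrow> a < fst (L ! q)"
  shows "scan_left (map snd L) p k < length L \<and> L ! scan_left (map snd L) p k = (v, k)"
proof -
  let ?Q = "{q. q < length L \<and> snd (L ! q) = k \<and> (a < v \<longrightarrow> a < fst (L ! q))}"
  obtain q where q: "q < length L" "L ! q = (v, k)"
    using first(1) by (metis in_set_conv_nth)
  have "Max ?Q < length L \<and> L ! Max ?Q = (v, k)"
  proof (rule nth_Max_sorted[OF sorted, of _ q])
    fix q'
    assume q': "q' \<in> ?Q"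
    then have "(fst (L ! q'), k) \<in> set L"
      by (metis (mono_tags, lifting) mem_Collect_eq nth_mem prod.collapse)
    with q' show "snd (L ! q') = k \<and> v \<le> fst (L ! q')"
      using first(2) by (fastforce simp: cyc_le_def)
  qed (use q in auto)
  moreover have "scan_left (map snd L) p k = Max ?Q"
    using first p by (rule scan_left_eq_Max)
  ultimately show ?thesis
    by simp
qed

definition greedy_row :: "('a::linorder \<times> nat) list \<Rightarrow> nat \<Rightarrow> (nat \<Rightarrow> 'a) \<Rightarrow> bool" where
  "greedy_row L m f \<longleftrightarrow>
     (\<forall>j\<in>{1..m}. (f j, j) \<in> set L) \<and>
     (\<forall>(c, j)\<in>set L. j \<in> {1..m} \<and> c \<le> f 0 \<and> cyc_le (f (j - 1)) (f j) c)"

lemma greedy_row_0: "greedy_row L 0 f \<Longrightarrow> L = []"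
  by (cases L) (auto simp: greedy_row_def)

lemma std_pos_greedy_row:
  assumes sorted: "sorted_wrt array_le L" and greedy: "greedy_row L m f" and "j \<in> {1..m}"
  shows "std_pos (map snd L) j < length L \<and> L ! std_pos (map snd L) j = (f j, j)"
  using \<open>j \<in> {1..m}\<close>
proof (induction j)
  case (Suc i)
  have entry: "(f (Suc i), Suc i) \<in> set L"
    using greedy Suc.prems by (simp add: greedy_row_def)
  have first: "cyc_le (f i) (f (Suc i)) c" if "(c, Suc i) \<in> set L" for c
    using greedy that by (fastforce simp: greedy_row_def)
  show ?case
  proof (cases "i = 0")
    case True
    have "fst (L ! q) \<le> f i" if "q < length L" for q
      using greedy nth_mem[OF that] True by (cases "L ! q") (auto simp: greedy_row_def)
    then have "scan_left (map snd L) 0 (Suc i) < length L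
        \<and> L ! scan_left (map snd L) 0 (Suc i) = (f (Suc i), Suc i)"
      by (intro scan_left_array[OF sorted entry first]) (auto simp: not_less)
    moreover have "scan_left (map snd L) (length L) (Suc i) = scan_left (map snd L) 0 (Suc i)"
      by (auto simp: scan_left_def)
    ultimately show ?thesis
      using True by simp
  next
    case False
    define p where "p = std_pos (map snd L) i"
    have p: "p < length L" "L ! p = (f i, i)"
      using Suc False by (simp_all add: p_def)
    have "q < p \<longleftrightarrow> f i < fst (L ! q)" if "q < length L" "snd (L ! q) = Suc i" for q
      using array_nth_less_iff[OF sorted that(1) p(1) _ p(2)] that(2) by (cases "L ! q") auto
    then show ?thesis
      using scan_left_array[OF sorted entry first, of p] p(1) by (simp add: p_def)
  qed
qed simp

lemma nths_std_positions_greedy_row: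
  assumes sorted: "sorted_wrt array_le L" and greedy: "greedy_row L m f"
  shows "mset (nths L (std_positions (map snd L))) = cells (m, f)"
proof (cases "m = 0")
  case True
  with greedy have "L = []"
    using greedy_row_0 by blast
  with True show ?thesis
    by simp
next
  case False
  let ?pos = "std_pos (map snd L)"
  have pos: "?pos j < length L" "L ! ?pos j = (f j, j)" if "j \<in> {1..m}" for j
    using std_pos_greedy_row[OF sorted greedy that] by simp_all
  have "(f m, m) \<in> set L"
    using greedy False by (simp add: greedy_row_def)
  then have "Max (set (map snd L)) = m"
    using greedy by (intro Max_eqI) (force simp: greedy_row_def)+
  then have "{i. i < length L \<and> i \<in> std_positions (map snd L)} = ?pos ` {1..m}"
    using pos by (auto simp: std_positions_def)
  moreover have "inj_on ?pos {1..m}"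
    by (rule inj_onI) (metis pos(2) snd_conv)
  ultimately have "mset (nths L (std_positions (map snd L)))
      = image_mset (\<lambda>j. L ! ?pos j) (mset_set {1..m})"
    by (simp add: mset_nths image_mset_mset_set[symmetric] image_mset.compositionality o_def)
  also have "\<dots> = cells (m, f)"
    unfolding cells_conv_image_mset using pos by (intro image_mset_cong) simp
  finally show ?thesis .
qed

lemma cocharge_greedy_row:
  assumes sorted: "sorted_wrt array_le L" and greedy: "greedy_row L m f"
  shows "cocharge (map snd L)
    = row_maj (m, f) + cocharge (map snd (nths L (- std_positions (map snd L))))"
proof (cases "m = 0")
  case True
  with greedy have "L = []"
    using greedy_row_0 by blast
  with True show ?thesis
    by simp
next
  case False
  then have "(f 1, 1) \<in> set L"
    using greedy by (simp add: greedy_row_def)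
  then have "1 \<in> set (map snd L)" "f 1 \<le> f 0"
    using greedy by (force simp: greedy_row_def)+
  moreover have "cocharge_perm (map snd (nths L (std_positions (map snd L)))) = row_maj (m, f)"
    using \<open>f 1 \<le> f 0\<close> nths_std_positions_greedy_row[OF assms]
    by (intro cocharge_perm_eq_row_maj sorted_wrt_nths sorted)
  ultimately show ?thesis
    by (subst cocharge.simps) (simp add: std_subword_def std_remainder_def nths_map)
qed

lemma greedy_row_first:
  assumes rows: "inv_free_rows t ((m, f) # rs)" and longest: "\<forall>S\<in>set rs. fst S \<le> m"
    and L: "mset L = sum_list (map cells ((m, f) # rs))"
  shows "greedy_row L m f"
proof -
  have entry_iff: "(c, j) \<in> set L \<longleftrightarrow> (\<exists>(p, x)\<in>set ((m, f) # rs). j \<in> {1..p} \<and> c = x j)" for c j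
  proof -
    have "(c, j) \<in> set L \<longleftrightarrow> (\<exists>R\<in>set ((m, f) # rs). (c, j) \<in># cells R)"
      unfolding set_mset_mset[symmetric] L set_mset_sum_list by auto
    moreover have "(c, j) \<in># cells R \<longleftrightarrow> (case R of (p, x) \<Rightarrow> j \<in> {1..p} \<and> c = x j)" for R
      by (cases R) (auto simp: cells_conv_image_mset simp del: cells.simps)
    ultimately show ?thesis
      by (simp only:)
  qed
  have "j \<in> {1..m} \<and> c \<le> f 0 \<and> cyc_le (f (j - 1)) (f j) c" if c: "(c, j) \<in> set L" for c j
  proof -
    obtain p x where px: "(p, x) \<in> set ((m, f) # rs)" "j \<in> {1..p}" "c = x j"
      using c unfolding entry_iff by blast
    then have "p \<le> m"
      using longest by auto
    moreover have "c \<le> f 0"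
      using rows px by (fastforce simp: inv_free_rows_def)
    moreover have "cyc_le (f (j - 1)) (f j) c"
    proof (cases "(p, x) = (m, f)")
      case False
      then have "avoids p f (x \<circ> Suc)"
        using rows px \<open>p \<le> m\<close> by (auto simp: inv_free_rows_def)
      with px(2,3) show ?thesis
        using avoidsD[of p f "x \<circ> Suc" "j - 1"] by (cases j) auto
    qed (use px in simp)
    ultimately show ?thesis
      using px(2) by simp
  qed
  moreover have "(f j, j) \<in> set L" if "j \<in> {1..m}" for j
    unfolding entry_iff using that by simp
  ultimately show ?thesis
    unfolding greedy_row_def by blast
qed

theorem cocharge_inv_free_rows:
  assumes "inv_free_rows t rs" "sorted_wrt array_le L" "mset L = sum_list (map cells rs)"
  shows "cocharge (map snd L) = sum_list (map row_maj rs)"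
  using assms
proof (induction "length rs" arbitrary: rs L)
  case 0
  then show ?case
    by (simp add: cocharge.simps)
next
  case (Suc k)
  then have "rs \<noteq> []"
    by auto
  with Suc.prems(1) obtain m f rs'
    where rs': "inv_free_rows t ((m, f) # rs')" "\<forall>S\<in>set rs'. fst S \<le> m"
    and statistics: "same_statistics ((m, f) # rs') rs"
    by (rule longest_row_first)
  let ?L' = "nths L (- std_positions (map snd L))"
  have L: "mset L = sum_list (map cells ((m, f) # rs'))"
    using statistics Suc.prems(3) by (simp add: same_statistics_def)
  have greedy: "greedy_row L m f"
    using rs' L by (rule greedy_row_first)
  have "mset ?L' = sum_list (map cells rs')"
    using mset_nths_Compl[of L "std_positions (map snd L)"]
      nths_std_positions_greedy_row[OF Suc.prems(2) greedy] L
    by (simp del: cells.simps)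
  moreover have "k = length rs'"
    using statistics Suc.hyps(2) mset_eq_length unfolding same_statistics_def by fastforce
  moreover have "inv_free_rows t rs'"
    using rs'(1) by (simp add: inv_free_rows_def)
  ultimately have "cocharge (map snd ?L') = sum_list (map row_maj rs')"
    using Suc.hyps(1) sorted_wrt_nths[OF Suc.prems(2)] by blast
  then show ?case
    using cocharge_greedy_row[OF Suc.prems(2) greedy] statistics
    by (simp add: same_statistics_def del: row_maj.simps)
qed


subsection \<open>Inversion-free fillings\<close>

lemma ex_rotate_iff: "xs \<noteq> [] \<Longrightarrow> (\<exists>i. P (rotate i xs)) \<longleftrightarrow> (\<exists>i<length xs. P (rotate i xs))"
  by (metis length_greater_0_conv mod_less_divisor rotate_conv_mod)

lemma ex_rotate3_iff: "(\<exists>i. P (rotate i [a, b, c])) \<longleftrightarrow> P [a, b, c] \<or> P [b, c, a] \<or> P [c, a, b]"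
  by (subst ex_rotate_iff) (auto simp: Ex_less_Suc)

lemma inversion_typeA_iff: "inversion_typeA F (a, b, c) \<longleftrightarrow> \<not> cyc_le (F a) (F b) (F c)"
  unfolding inversion_typeA_def prod.case ex_rotate3_iff by (auto simp: cyc_le_def)

lemma inversion_typeB_iff: "inversion_typeB F (a, b, c) \<longleftrightarrow> \<not> cyc_le (F a) (F b) (F c)"
  unfolding inversion_typeB_def prod.case ex_rotate3_iff by (auto simp: cyc_le_def)

lemma inv_free_filling: "F \<in> inv_free n \<alpha> \<sigma> \<Longrightarrow> F \<in> fillings n \<alpha> \<sigma>"
  by (simp add: inv_free_def)

lemma inv_free_typeA:
  assumes "F \<in> inv_free n \<alpha> \<sigma>" "r \<in> {1..n}" "k \<in> {1..n}" "r < k" "\<alpha> k \<le> \<alpha> r" "j < \<alpha> k"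
  shows "cyc_le (F (r, j)) (F (r, Suc j)) (F (k, Suc j))"
proof -
  have "((r, Suc j - 1), (r, Suc j), (k, Suc j)) \<in> typeA_triples n \<alpha>"
    unfolding typeA_triples_def
    by (intro CollectI, rule exI[of _ r], rule exI[of _ k], rule exI[of _ "Suc j"])
      (use assms(2-) in \<open>auto simp: aug_diagram_def\<close>)
  then have "\<not> inversion_typeA F ((r, Suc j - 1), (r, Suc j), (k, Suc j))"
    using assms(1) unfolding inv_free_def by blast
  then show ?thesis
    by (simp add: inversion_typeA_iff)
qed

lemma inv_free_typeB:
  assumes "F \<in> inv_free n \<alpha> \<sigma>" "r \<in> {1..n}" "k \<in> {1..n}" "r < k" "\<alpha> r < \<alpha> k" "j \<le> \<alpha> r"
  shows "cyc_le (F (k, j)) (F (k, Suc j)) (F (r, j))"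
proof -
  have "((k, Suc j - 1), (k, Suc j), (r, Suc j - 1)) \<in> typeB_triples n \<alpha>"
    unfolding typeB_triples_def
    by (intro CollectI, rule exI[of _ k], rule exI[of _ r], rule exI[of _ "Suc j"])
      (use assms(2-) in \<open>auto simp: aug_diagram_def\<close>)
  then have "\<not> inversion_typeB F ((k, Suc j - 1), (k, Suc j), (r, Suc j - 1))"
    using assms(1) unfolding inv_free_def by blast
  then show ?thesis
    by (simp add: inversion_typeB_iff)
qed

lemma filling_less_Infty:
  assumes "F \<in> fillings n \<alpha> \<sigma>" "r \<in> {1..n}" "j \<in> {1..\<alpha> r}"
  shows "F (r, j) < Infty i"
proof -
  have "(r, j) \<in> diagram n \<alpha>"
    using assms(2,3) by (simp add: diagram_def aug_diagram_def)
  with assms(1) obtain m where "F (r, j) = Num m"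
    unfolding fillings_def by blast
  then show ?thesis
    by simp
qed

lemma filling_basement: "F \<in> fillings n \<alpha> \<sigma> \<Longrightarrow> r \<in> {1..n} \<Longrightarrow> F (r, 0) = Infty (\<sigma> r)"
  by (simp add: fillings_def)

text \<open>With a common basement entry, the type B conditions on column 1 become void.\<close>

definition filling_row :: "(nat \<Rightarrow> nat) \<Rightarrow> (box \<Rightarrow> entry) \<Rightarrow> nat \<Rightarrow> entry row" where
  "filling_row \<alpha> F r = (\<alpha> r, \<lambda>j. if j = 0 then Infty 0 else F (r, j))"

definition filling_rows :: "nat \<Rightarrow> (nat \<Rightarrow> nat) \<Rightarrow> (box \<Rightarrow> entry) \<Rightarrow> entry row list" where
  "filling_rows n \<alpha> F = map (filling_row \<alpha> F) [1..<Suc n]"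

lemma cyc_le_top: "b \<le> t \<Longrightarrow> c \<le> t \<Longrightarrow> cyc_le t b c \<longleftrightarrow> b \<le> c"
  by (auto simp: cyc_le_def)

lemma inv_free_pair_filling_row:
  assumes F: "F \<in> inv_free n \<alpha> \<sigma>" and rk: "r \<in> {1..n}" "k \<in> {1..n}" "r < k"
  shows "inv_free_pair (filling_row \<alpha> F r) (filling_row \<alpha> F k)"
proof -
  define x where "x i j = (if j = 0 then Infty 0 else F (i, j))" for i j
  have filling: "F \<in> fillings n \<alpha> \<sigma>"
    using F by (rule inv_free_filling)
  have "avoids (\<alpha> k) (x r) (x k \<circ> Suc)" if le: "\<alpha> k \<le> \<alpha> r"
  proof (rule avoidsI)
    fix j
    assume j: "j < \<alpha> k"
    note typeA = inv_free_typeA[OF F rk le j]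
    have "F (r, 1) \<le> Infty i" "F (k, 1) \<le> Infty i" for i
      using filling_less_Infty[OF filling] rk le j by (simp_all add: less_imp_le)
    then have "cyc_le (Infty 0) (F (r, 1)) (F (k, 1))" if "j = 0"
      using typeA that by (simp add: filling_basement[OF filling rk(1)] cyc_le_top)
    with typeA show "cyc_le (x r j) (x r (Suc j)) ((x k \<circ> Suc) j)"
      by (simp add: x_def)
  qed
  moreover have "avoids (Suc (\<alpha> r)) (x k) (x r)" if "\<alpha> r < \<alpha> k"
    using inv_free_typeB[OF F rk that] by (auto simp: avoids_def x_def)
  ultimately show ?thesis
    by (simp add: filling_row_def x_def[symmetric])
qed

lemma inv_free_rows_filling_rows:
  assumes "F \<in> inv_free n \<alpha> \<sigma>"
  shows "inv_free_rows (Infty 0) (filling_rows n \<alpha> F)"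
proof -
  have "sorted_wrt inv_free_pair (filling_rows n \<alpha> F)"
    unfolding filling_rows_def sorted_wrt_map
    using inv_free_pair_filling_row[OF assms]
    by (intro sorted_wrt_mono_rel[OF _ sorted_wrt_upt]) (auto simp del: upt_Suc)
  moreover have "row_bounded (Infty 0) (filling_row \<alpha> F r)" if "r \<in> {1..n}" for r
    using filling_less_Infty[OF inv_free_filling[OF assms] that]
    by (auto simp: filling_row_def less_imp_le)
  ultimately show ?thesis
    by (auto simp: inv_free_rows_def filling_rows_def simp del: upt_Suc)
qed

lemma sum_list_filling_rows:
  fixes g :: "entry row \<Rightarrow> 'b::comm_monoid_add"
  shows "sum_list (map g (filling_rows n \<alpha> F)) = (\<Sum>r = 1..n. g (filling_row \<alpha> F r))"
  by (simp add: filling_rows_def interv_sum_list_conv_sum_set_nat o_def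
      atLeastLessThanSuc_atLeastAtMost del: upt_Suc)

lemma diagram_eq_Sigma: "diagram n \<alpha> = (SIGMA r:{1..n}. {1..\<alpha> r})"
  by (auto simp: diagram_def aug_diagram_def)

lemma mset_two_line_array_eq_cells:
  "mset (two_line_array n \<alpha> F) = sum_list (map cells (filling_rows n \<alpha> F))"
proof -
  have "mset (two_line_array n \<alpha> F) = (\<Sum>(r, j)\<in>diagram n \<alpha>. {#(F (r, j), j)#})"
    by (simp add: mset_two_line_array sum_unfold_sum_mset case_prod_unfold)
  also have "\<dots> = (\<Sum>r = 1..n. \<Sum>j = 1..\<alpha> r. {#(F (r, j), j)#})"
    by (simp add: diagram_eq_Sigma sum.Sigma)
  also have "\<dots> = sum_list (map cells (filling_rows n \<alpha> F))"
    unfolding sum_list_filling_rows by (intro sum.cong) (simp_all add: filling_row_def)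
  finally show ?thesis .
qed

lemma row_maj_conv_leg: "row_maj (p, x) = (\<Sum>j = 1..p. (p - j + 1) * asc (x (j - 1)) (x j))"
proof (induction p)
  case (Suc p)
  have ascents: "ascents x r = (\<Sum>j = 1..r. asc (x (j - 1)) (x j))" for r
    by (induction r) simp_all
  have "(\<Sum>j = 1..Suc p. (Suc p - j + 1) * asc (x (j - 1)) (x j))
      = (\<Sum>j = 1..p. (p - j + 1) * asc (x (j - 1)) (x j) + asc (x (j - 1)) (x j))
        + asc (x p) (x (Suc p))"
    by (simp add: Suc_diff_le ac_simps)
  with Suc show ?case
    by (simp add: sum.distrib ascents)
qed simp

lemma maj_eq_sum_row_maj:
  assumes F: "F \<in> fillings n \<alpha> \<sigma>"
  shows "maj n \<alpha> F = sum_list (map row_maj (filling_rows n \<alpha> F))"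
proof -
  have "maj n \<alpha> F = (\<Sum>(r, j)\<in>diagram n \<alpha>. (leg \<alpha> (r, j) + 1) * asc (F (r, j - 1)) (F (r, j)))"
    unfolding maj_def diagram_eq_Sigma by (rule sum.mono_neutral_cong_left) (auto simp: asc_def)
  also have "\<dots> = (\<Sum>r = 1..n. \<Sum>j = 1..\<alpha> r. (leg \<alpha> (r, j) + 1) * asc (F (r, j - 1)) (F (r, j)))"
    unfolding diagram_eq_Sigma by (simp add: sum.Sigma)
  also have "\<dots> = (\<Sum>r = 1..n. row_maj (filling_row \<alpha> F r))"
  proof (intro sum.cong refl)
    fix r
    assume r: "r \<in> {1..n}"
    have "asc (Infty i) (F (r, 1)) = 0" if "1 \<le> \<alpha> r" for i
      using filling_less_Infty[OF F r, of 1 i] that by (simp add: asc_def)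
    then show "(\<Sum>j = 1..\<alpha> r. (leg \<alpha> (r, j) + 1) * asc (F (r, j - 1)) (F (r, j)))
        = row_maj (filling_row \<alpha> F r)"
      unfolding filling_row_def row_maj_conv_leg
      by (intro sum.cong refl) (auto simp: leg_def filling_basement[OF F r] le_Suc_eq)
  qed
  finally show ?thesis
    unfolding sum_list_filling_rows .
qed

theorem cocharge_ccw_eq_maj:
  assumes F: "F \<in> inv_free n \<alpha> \<sigma>"
  shows "cocharge (ccw n \<alpha> F) = maj n \<alpha> F"
proof -
  have "cocharge (ccw n \<alpha> F) = sum_list (map row_maj (filling_rows n \<alpha> F))"
    unfolding ccw_def
    using inv_free_rows_filling_rows[OF F] sorted_two_line_array mset_two_line_array_eq_cells
    by (rule cocharge_inv_free_rows)
  also have "\<dots> = maj n \<alpha> F"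
    using maj_eq_sum_row_maj[OF inv_free_filling[OF F]] ..
  finally show ?thesis .
qed

theorem theorem5p10:
  fixes n :: nat and lam :: "nat \<Rightarrow> nat" and \<tau> :: "nat \<Rightarrow> nat" and F :: "box \<Rightarrow> entry"
  assumes partition: "\<forall>i j. 1 \<le> i \<and> i \<le> j \<and> j \<le> n \<longrightarrow> lam j \<le> lam i"
    and perm: "\<tau> permutes {1..n}"
    and F: "F \<in> inv_free n (perm_act \<tau> lam) (perm_act \<tau> (w0 n))"
  shows "cocharge (ccw n (perm_act \<tau> lam) F) = maj n (perm_act \<tau> lam) F"
  using F by (rule cocharge_ccw_eq_maj)

end
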